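(* Let $\mathcal{A}=(\mathcal{H},|s_0\rangle,\Sigma,\{U_\sigma\}_{\sigma\in\Sigma},F)$ be a quantum automaton. For any nonempty finite word $w\in\Sigma^+$ and any $\varepsilon>0$, there is a positive integer $k$ such that $$\bigl|f^{\mathrm{ND}}_{\mathcal{A}}(uv)-f^{\mathrm{ND}}_{\mathcal{A}}(uw^kv)\bigr|\le\varepsilon$$ for all finite words $u\in\Sigma^*$ and all infinite words $v\in\Sigma^\omega$. Moreover, if $\mathcal{H}$ is $n$-dimensional, there is a constant $c$ such that such a $k$ can be chosen with $k\le (c\varepsilon)^{-n}$.
   Context: A quantum automaton is a tuple $\mathcal{A}=(\mathcal{H},|s_0\rangle,\Sigma,\{U_\sigma:\sigma\in\Sigma\},F)$ where $\mathcal{H}$ is a finite-dimensional complex Hilbert space, $|s_0\rangle\in\mathcal{H}$ is a unit vector (initial state), $\Sigma$ is a finite alphabet, each $U_\sigma$ is a unitary operator on $\mathcal{H}$, and $F$ is a subspace of $\mathcal{H}$ (accepting space). For a finite word $x=\sigma_1\cdots\sigma_m$ put $U_x=U_{\sigma_m}\cdots U_{\sigma_1}$ ($U_\epsilon=I$). For an infinite word $w=\sigma_1\sigma_2\cdots\in\Sigma^\omega$, let $w_n$ denote its prefix of length $n$; the non-disturbing run of $\mathcal{A}$ over $w$ is $|s_n\rangle=U_{w_n}|s_0\rangle$, $n\ge0$. The non-disturbing Büchi acceptance probability is $$f^{\mathrm{ND}}_{\mathcal{A}}(w)=\sup_{|\psi\rangle\in F,\ \||\psi\rangle\|=1}\ \sup_{\{n_i\}}\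 \inf_{i\ge1}|\langle\psi|s_{n_i}\rangle|^2,$$ where $\{n_i\}$ ranges over all strictly increasing sequences $0\le n_1<n_2<\cdots$ of natural numbers. $w^k$ denotes the $k$-fold concatenation of $w$. *)

theory Defs
  imports "HOL-Analysis.Analysis"
begin

text \<open>Hilbert space: complex^'n (finite index type 'n, dimension CARD('n)).
  Operators: matrices complex^'n^'n acting by *v.\<close>

definition adj_mat :: "complex^'n^'n \<Rightarrow> complex^'n^'n" where
  "adj_mat A = (\<chi> i j. cnj (A $ j $ i))"

definition unitary_mat :: "complex^'n^'n \<Rightarrow> bool" where
  "unitary_mat A \<longleftrightarrow> adj_mat A ** A = mat 1 \<and> A ** adj_mat A = mat 1"

text \<open>complex-linear subspace\<close>
definition complex_subspace :: "(complex^'n) set \<Rightarrow> bool" where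
  "complex_subspace F \<longleftrightarrow> 0 \<in> F \<and> (\<forall>x\<in>F. \<forall>y\<in>F. x + y \<in> F)
     \<and> (\<forall>c::complex. \<forall>x\<in>F. c *s x \<in> F)"

text \<open>Hermitian inner product, conjugate-linear in the first argument: <psi|s>\<close>
definition braket :: "complex^'n \<Rightarrow> complex^'n \<Rightarrow> complex" where
  "braket psi s = (\<Sum>i\<in>UNIV. cnj (psi $ i) * s $ i)"

definition is_QA :: "complex^'n \<Rightarrow> ('a::finite \<Rightarrow> complex^'n^'n) \<Rightarrow> (complex^'n) set \<Rightarrow> bool" where
  "is_QA s0 U F \<longleftrightarrow> norm s0 = 1 \<and> (\<forall>\<sigma>. unitary_mat (U \<sigma>)) \<and> complex_subspace F"

text \<open>Non-disturbing run over an infinite word w: s_0 = s0, s_(n+1) = U_(w n) s_n\<close>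
fun qrun :: "('a \<Rightarrow> complex^'n^'n) \<Rightarrow> complex^'n \<Rightarrow> (nat \<Rightarrow> 'a) \<Rightarrow> nat \<Rightarrow> complex^'n" where
  "qrun U s0 w 0 = s0"
| "qrun U s0 w (Suc n) = U (w n) *v qrun U s0 w n"

text \<open>Non-disturbing Buechi acceptance probability. The supremum is taken with 0 adjoined
  (all values are >= 0, so this only fixes the convention sup of empty set = 0 when F = {0}).\<close>
definition fND :: "('a \<Rightarrow> complex^'n^'n) \<Rightarrow> complex^'n \<Rightarrow> (complex^'n) set \<Rightarrow> (nat \<Rightarrow> 'a) \<Rightarrow> real" where
  "fND U s0 F w = Sup (insert 0
     {Inf (range (\<lambda>i::nat. (cmod (braket psi (qrun U s0 w (r i))))\<^sup>2)) | psi r.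
        psi \<in> F \<and> norm psi = 1 \<and> strict_mono r})"

text \<open>Concatenation of a finite word and an infinite word\<close>
definition conc_word :: "'a list \<Rightarrow> (nat \<Rightarrow> 'a) \<Rightarrow> nat \<Rightarrow> 'a" where
  "conc_word u v = (\<lambda>i. if i < length u then u ! i else v (i - length u))"

text \<open>k-fold concatenation of a finite word\<close>
definition word_pow :: "'a list \<Rightarrow> nat \<Rightarrow> 'a list" where
  "word_pow w k = concat (replicate k w)"

end

theory Submission
  imports Defs "HOL-Computational_Algebra.Fundamental_Theorem_Algebra"
begin

text \<open>Reading \<open>w\<^sup>k\<close> multiplies the state by \<open>M\<^sup>k\<close>, where \<open>M = U\<^sub>w\<close> is unitary. By the
  spectral theorem \<open>M\<close> has an orthonormal eigenbasis with eigenvalues on the unit circle, and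
  Dirichlet's simultaneous approximation theorem yields some \<open>0 < k \<le> (10/\<delta>)\<^sup>n\<close> with
  \<open>|\<lambda>\<^sup>k - 1| \<le> \<delta>\<close> for all eigenvalues \<open>\<lambda>\<close>, hence \<open>\<parallel>M\<^sup>k x - x\<parallel> \<le> \<delta> \<parallel>x\<parallel>\<close>.
  Since the letters of \<open>v\<close> act isometrically, the runs over \<open>uv\<close> and \<open>uw\<^sup>kv\<close> stay
  \<open>\<delta>\<close>-close after their prefixes. As \<open>|\<langle>\<psi>|x\<rangle>|\<^sup>2\<close> is 2-Lipschitz on the unit ball and
  every subsequence of one run is matched by the shifted subsequence of the other, the acceptance
  values then differ by at most \<open>2\<delta>\<close>; \<open>\<delta> = \<epsilon>/2\<close> gives \<open>c = 1/20\<close>.\<close>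

section \<open>The Hermitian inner product\<close>

lemma braket_add_left: "braket (a + b) c = braket a c + braket b c"
  unfolding braket_def by (simp add: distrib_right sum.distrib)

lemma braket_add_right: "braket a (b + c) = braket a b + braket a c"
  unfolding braket_def by (simp add: distrib_left sum.distrib)

lemma braket_diff_right: "braket a (b - c) = braket a b - braket a c"
  unfolding braket_def by (simp add: right_diff_distrib sum_subtractf)

lemma braket_scale_left: "braket (c *s a) b = cnj c * braket a b"
  unfolding braket_def by (simp add: sum_distrib_left algebra_simps)

lemma braket_scale_right: "braket a (c *s b) = c * braket a b"
  unfolding braket_def by (simp add: sum_distrib_left algebra_simps)

lemma braket_zero_left [simp]: "braket 0 a = 0"
  unfolding braket_def by simp

lemma braket_zero_right [simp]: "braket a 0 = 0"
  unfolding braket_def by simp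

lemma braket_sum_left: "braket (\<Sum>i\<in>I. f i) a = (\<Sum>i\<in>I. braket (f i) a)"
  by (induction I rule: infinite_finite_induct) (auto simp: braket_add_left)

lemma braket_sum_right: "braket a (\<Sum>i\<in>I. f i) = (\<Sum>i\<in>I. braket a (f i))"
  by (induction I rule: infinite_finite_induct) (auto simp: braket_add_right)

lemma cnj_braket: "cnj (braket a b) = braket b a"
  unfolding braket_def by (simp add: mult.commute)

lemma braket_self: "braket x x = of_real ((norm x)\<^sup>2)"
proof -
  have "(norm x)\<^sup>2 = (\<Sum>i\<in>UNIV. (cmod (x$i))\<^sup>2)"
    unfolding norm_vec_def L2_set_def by (simp add: sum_nonneg)
  moreover have "cnj z * z = of_real ((cmod z)\<^sup>2)" for z
    by (simp only: complex_norm_square mult.commute)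
  ultimately show ?thesis
    unfolding braket_def of_real_sum by simp
qed

lemma norm_eq_1_iff_braket: "norm x = 1 \<longleftrightarrow> braket x x = 1"
  unfolding braket_self of_real_eq_1_iff power2_eq_1_iff using norm_ge_zero[of x] by linarith

lemma norm_braket_le: "cmod (braket a b) \<le> norm a * norm b"
proof -
  have "cmod (braket a b) \<le> (\<Sum>i\<in>UNIV. cmod (cnj (a$i) * b$i))"
    unfolding braket_def by (rule norm_sum)
  also have "\<dots> = (\<Sum>i\<in>UNIV. cmod (a$i) * cmod (b$i))"
    by (simp add: norm_mult)
  also have "\<dots> \<le> norm a * norm b"
    unfolding norm_vec_def using L2_set_mult_ineq[of "\<lambda>i. cmod (a$i)" "\<lambda>i. cmod (b$i)" UNIV] by simp
  finally show ?thesis .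
qed

lemma norm_vector_scale: "norm (c *s (x::complex^'n)) = cmod c * norm x"
  by (simp add: norm_vec_def norm_mult L2_set_right_distrib)

lemma braket_adj_mat: "braket (A *v x) y = braket x (adj_mat A *v y)"
  unfolding braket_def adj_mat_def matrix_vector_mult_def
  by (simp add: sum_distrib_left sum_distrib_right algebra_simps) (rule sum.swap)

definition orthonormal :: "(complex^'n) set \<Rightarrow> bool" where
  "orthonormal B \<longleftrightarrow> (\<forall>e\<in>B. \<forall>e'\<in>B. braket e e' = (if e = e' then 1 else 0))"

lemma orthonormalD: "orthonormal B \<Longrightarrow> e \<in> B \<Longrightarrow> e' \<in> B \<Longrightarrow> braket e e' = (if e = e' then 1 else 0)"
  unfolding orthonormal_def by blast

lemma braket_sum_orthonormal:
  assumes "finite B" "orthonormal B" "e \<in> B"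
  shows "braket e (\<Sum>e'\<in>B. a e' *s e') = a e"
proof -
  have "braket e (\<Sum>e'\<in>B. a e' *s e') = (\<Sum>e'\<in>B. if e = e' then a e' else 0)"
    using assms(2,3) by (auto simp: braket_sum_right braket_scale_right orthonormalD intro: sum.cong)
  with assms(1,3) show ?thesis by simp
qed

lemma norm_sum_orthonormal:
  assumes "finite B" "orthonormal B"
  shows "(norm (\<Sum>e\<in>B. a e *s e))\<^sup>2 = (\<Sum>e\<in>B. (cmod (a e))\<^sup>2)"
proof -
  have "braket (\<Sum>e\<in>B. a e *s e) (\<Sum>e\<in>B. a e *s e) = (\<Sum>e\<in>B. cnj (a e) * a e)"
    using assms by (simp add: braket_sum_left braket_scale_left braket_sum_orthonormal)
  also have "\<dots> = (\<Sum>e\<in>B. of_real ((cmod (a e))\<^sup>2))"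
    by (simp only: complex_norm_square mult.commute)
  finally show ?thesis
    unfolding braket_self of_real_sum[symmetric] of_real_eq_iff .
qed

lemma card_orthonormal_le:
  fixes B :: "(complex^'n) set"
  assumes "finite B" "orthonormal B"
  shows "card B \<le> CARD('n)"
proof -
  have "vec.independent B"
    unfolding vec.independent_explicit
  proof (intro conjI allI impI ballI)
    fix c v assume comb: "(\<Sum>v\<in>B. c v *s v) = 0" and "v \<in> B"
    show "c v = 0"
      using braket_sum_orthonormal[OF assms \<open>v \<in> B\<close>, of c] by (simp add: comb)
  qed fact
  then have "card B \<le> vec.dim (UNIV :: (complex^'n) set)"
    using vec.independent_bound_general vec.dim_subset[of B UNIV] by fastforce
  then show ?thesis unfolding vec_dim_card .
qed

section \<open>Unitary matrices\<close>

lemma adj_mat_mult: "adj_mat (A ** B) = adj_mat B ** adj_mat A"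
  unfolding adj_mat_def matrix_matrix_mult_def
  by (simp add: vec_eq_iff mult.commute)

lemma unitary_mat_one: "unitary_mat (mat 1)"
proof -
  have "adj_mat (mat 1) = mat 1"
    by (simp add: adj_mat_def vec_eq_iff mat_def)
  then show ?thesis
    by (simp add: unitary_mat_def)
qed

lemma unitary_mat_mult:
  assumes "unitary_mat A" "unitary_mat B"
  shows "unitary_mat (A ** B)"
proof -
  have "adj_mat (A ** B) ** (A ** B) = adj_mat B ** ((adj_mat A ** A) ** B)"
    "(A ** B) ** adj_mat (A ** B) = A ** ((B ** adj_mat B) ** adj_mat A)"
    by (simp_all add: adj_mat_mult matrix_mul_assoc)
  with assms show ?thesis
    unfolding unitary_mat_def by simp
qed

lemma unitary_mat_braket: "unitary_mat A \<Longrightarrow> braket (A *v x) (A *v y) = braket x y"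
  unfolding unitary_mat_def braket_adj_mat by (simp add: matrix_vector_mul_assoc)

lemma unitary_mat_norm:
  assumes "unitary_mat A"
  shows "norm (A *v x) = norm x"
proof -
  have "(norm (A *v x))\<^sup>2 = (norm x)\<^sup>2"
    using unitary_mat_braket[OF assms, of x x] unfolding braket_self of_real_eq_iff .
  then show ?thesis by simp
qed

lemma unitary_eigenvalue_norm:
  assumes "unitary_mat A" "A *v e = z *s e" "e \<noteq> 0"
  shows "cmod z = 1"
  using unitary_mat_norm[of A e] assms by (simp add: norm_vector_scale)

section \<open>Eigenvectors in invariant subspaces\<close>

definition poly_apply :: "complex^'n^'n \<Rightarrow> complex poly \<Rightarrow> complex^'n \<Rightarrow> complex^'n" where
  "poly_apply M p x = fold_coeffs (\<lambda>a y. a *s x + M *v y) p 0"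

lemma poly_apply_0 [simp]: "poly_apply M 0 x = 0"
  by (simp add: poly_apply_def)

lemma poly_apply_pCons [simp]: "poly_apply M (pCons a p) x = a *s x + M *v poly_apply M p x"
  by (cases "p = 0 \<and> a = 0") (auto simp: poly_apply_def)

lemma poly_apply_add: "poly_apply M (p + q) x = poly_apply M p x + poly_apply M q x"
proof (induction p arbitrary: q rule: pCons_induct)
  case (pCons a p)
  then show ?case
    by (cases q rule: pCons_cases) (simp add: matrix_vector_right_distrib vec.scale_left_distrib)
qed simp

lemma poly_apply_diff: "poly_apply M (p - q) x = poly_apply M p x - poly_apply M q x"
  using poly_apply_add[of M "p - q" q x] by simp

lemma poly_apply_smult: "poly_apply M (smult c p) x = c *s poly_apply M p x"
  by (induction p rule: pCons_induct) (simp_all add: vector_scalar_commute vec.scale_right_distrib)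

lemma poly_apply_linear_factor: "poly_apply M ([:-z, 1:] * q) x = M *v poly_apply M q x - z *s poly_apply M q x"
  by (simp add: poly_apply_diff poly_apply_smult)

lemma poly_apply_monom: "poly_apply M (monom c i) x = c *s ((*v) M ^^ i) x"
  by (induction i) (simp_all add: monom_0 monom_Suc vector_scalar_commute)

lemma poly_apply_sum: "poly_apply M (\<Sum>i\<in>I. p i) x = (\<Sum>i\<in>I. poly_apply M (p i) x)"
  by (induction I rule: infinite_finite_induct) (simp_all add: poly_apply_add)

lemma poly_apply_in_subspace:
  assumes "vec.subspace S" "\<forall>y\<in>S. M *v y \<in> S" "x \<in> S"
  shows "poly_apply M p x \<in> S"
  by (induction p rule: pCons_induct) (use assms in \<open>simp_all add: vec.subspace_0 vec.subspace_add vec.subspace_scale\<close>)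

lemma eigenvector_of_annihilating_poly:
  assumes S: "vec.subspace S" and inv: "\<forall>y\<in>S. M *v y \<in> S" and x: "x \<in> S" "x \<noteq> 0"
  shows "p \<noteq> 0 \<Longrightarrow> poly_apply M p x = 0 \<Longrightarrow> \<exists>y\<in>S. y \<noteq> 0 \<and> (\<exists>z. M *v y = z *s y)"
proof (induction "degree p" arbitrary: p rule: less_induct)
  case less
  show ?case
  proof (cases "degree p = 0")
    case True
    then obtain c where "p = [:c:]" by (rule degree_eq_zeroE)
    with less.prems x show ?thesis by simp
  next
    case False
    then obtain z where "poly p z = 0"
      using alg_closed_imp_poly_has_root by blast
    then obtain q where pq: "p = [:-z, 1:] * q"
      by (auto simp: poly_eq_0_iff_dvd)
    with less.prems(1) have "q \<noteq> 0" by auto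
    have "degree p = degree [:-z, 1:] + degree q"
      unfolding pq by (rule degree_mult_eq) (use \<open>q \<noteq> 0\<close> in auto)
    then have "degree q < degree p" by simp
    show ?thesis
    proof (cases "poly_apply M q x = 0")
      case True
      with less.hyps[OF \<open>degree q < degree p\<close> \<open>q \<noteq> 0\<close>] show ?thesis by blast
    next
      case False
      have "M *v poly_apply M q x = z *s poly_apply M q x"
        using less.prems(2) unfolding pq poly_apply_linear_factor by simp
      with False poly_apply_in_subspace[OF S inv x(1)] show ?thesis by blast
    qed
  qed
qed

text \<open>The \<open>n + 1\<close> vectors \<open>M\<^sup>i x\<close>, \<open>i \<le> n\<close>, are linearly dependent.\<close>

lemma annihilating_poly_exists:
  fixes M :: "complex^'n^'n"
  shows "\<exists>p. p \<noteq> 0 \<and> poly_apply M p x = 0"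
proof (cases "inj_on (\<lambda>i. ((*v) M ^^ i) x) {..CARD('n)}")
  case False
  then obtain i j where ij: "i \<noteq> j" "((*v) M ^^ i) x = ((*v) M ^^ j) x"
    unfolding inj_on_def by blast
  define p where "p = monom (1::complex) i - monom 1 j"
  have "coeff p i = 1" using ij unfolding p_def by simp
  moreover have "poly_apply M p x = 0"
    using ij by (simp add: p_def poly_apply_diff poly_apply_monom)
  ultimately show ?thesis by (metis coeff_0 zero_neq_one)
next
  case True
  define K where "K = (\<lambda>i. ((*v) M ^^ i) x) ` {..CARD('n)}"
  have "card K = Suc CARD('n)"
    unfolding K_def using card_image[OF True] by simp
  moreover have "vec.dim K \<le> CARD('n)"
    using vec.dim_subset[of K UNIV, unfolded vec_dim_card] by simp
  ultimately have "vec.dependent K"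
    by (intro vec.dependent_biggerset_general) simp
  moreover have "finite K" unfolding K_def by simp
  ultimately obtain u v where u: "(\<Sum>v\<in>K. u v *s v) = 0" "v \<in> K" "u v \<noteq> 0"
    using vec.dependent_finite by blast
  define p where "p = (\<Sum>i\<le>CARD('n). monom (u (((*v) M ^^ i) x)) i)"
  obtain j where j: "j \<le> CARD('n)" "v = ((*v) M ^^ j) x"
    using u(2) unfolding K_def by blast
  have "coeff p j = u v"
    using j by (simp add: p_def coeff_sum)
  moreover have "poly_apply M p x = (\<Sum>v\<in>K. u v *s v)"
    unfolding p_def K_def poly_apply_sum poly_apply_monom sum.reindex[OF True] by simp
  ultimately show ?thesis using u by (metis coeff_0)
qed

lemma invariant_subspace_unit_eigenvector:
  fixes M :: "complex^'n^'n"
  assumes S: "vec.subspace S" and inv: "\<forall>y\<in>S. M *v y \<in> S" and "\<not> S \<subseteq> {0}"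
  obtains e z where "e \<in> S" "norm e = 1" "M *v e = z *s e"
proof -
  obtain x where "x \<in> S" "x \<noteq> 0"
    using \<open>\<not> S \<subseteq> {0}\<close> by blast
  then obtain y z where y: "y \<in> S" "y \<noteq> 0" "M *v y = z *s y"
    using annihilating_poly_exists[of M x] eigenvector_of_annihilating_poly[OF S inv] by blast
  define e where "e = of_real (1 / norm y) *s y"
  have "e \<in> S"
    unfolding e_def using S y(1) by (rule vec.subspace_scale)
  moreover have "norm e = 1"
    using y(2) by (simp add: e_def norm_vector_scale norm_divide)
  moreover have "M *v e = z *s e"
    using y(3) by (simp add: e_def vector_scalar_commute mult.commute)
  ultimately show ?thesis
    using that by blast
qed

section \<open>The spectral theorem for unitary matrices\<close>

lemma unitary_eigenvector_orthogonal_invariant: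
  assumes M: "unitary_mat M" and Me: "M *v e = z *s e" and "braket e x = 0"
  shows "braket e (M *v x) = 0"
proof (cases "e = 0")
  case False
  then have "cnj z * z = 1"
    using unitary_eigenvalue_norm[OF M Me] complex_norm_square[of z] by (simp add: mult.commute)
  then have e_back: "e = cnj z *s (M *v e)"
    by (simp add: Me)
  have "braket e (M *v x) = z * braket (M *v e) (M *v x)"
    by (subst e_back) (simp add: braket_scale_left)
  also have "\<dots> = 0"
    using \<open>braket e x = 0\<close> by (simp add: unitary_mat_braket[OF M])
  finally show ?thesis .
qed simp

lemma orthonormal_insert_expansion:
  assumes S: "vec.subspace S" and e: "e \<in> S" "braket e e = 1"
    and B: "finite B" "B \<subseteq> {x \<in> S. braket e x = 0}" "orthonormal B"
    and expand: "\<forall>x \<in> {x \<in> S. braket e x = 0}. x = (\<Sum>e'\<in>B. braket e' x *s e')"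
  shows "orthonormal (insert e B)" "\<forall>x\<in>S. x = (\<Sum>e'\<in>insert e B. braket e' x *s e')"
proof -
  have eB: "e \<notin> B"
    using B(2) e(2) by auto
  have orth: "braket e e' = 0" "braket e' e = 0" if "e' \<in> B" for e'
    using that B(2) cnj_braket[of e e'] by auto
  show "orthonormal (insert e B)"
    using B(3) orth e(2) eB by (auto simp: orthonormal_def)
  show "\<forall>x\<in>S. x = (\<Sum>e'\<in>insert e B. braket e' x *s e')"
  proof
    fix x assume "x \<in> S"
    define x' where "x' = x - braket e x *s e"
    have "x' \<in> S" "braket e x' = 0"
      using \<open>x \<in> S\<close> S e by (auto simp: x'_def braket_diff_right braket_scale_right
          vec.subspace_diff vec.subspace_scale)
    then have "x' = (\<Sum>e'\<in>B. braket e' x' *s e')"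
      using expand by blast
    also have "\<dots> = (\<Sum>e'\<in>B. braket e' x *s e')"
      by (intro sum.cong) (auto simp: x'_def braket_diff_right braket_scale_right orth)
    finally show "x = (\<Sum>e'\<in>insert e B. braket e' x *s e')"
      using B(1) eB by (simp add: x'_def algebra_simps)
  qed
qed

lemma unitary_invariant_subspace_eigenbasis:
  fixes M :: "complex^'n^'n"
  assumes M: "unitary_mat M"
  shows "vec.subspace S \<Longrightarrow> \<forall>y\<in>S. M *v y \<in> S \<Longrightarrow>
    \<exists>B lam. finite B \<and> B \<subseteq> S \<and> orthonormal B \<and> (\<forall>e\<in>B. M *v e = lam e *s e) \<and>
      (\<forall>x\<in>S. x = (\<Sum>e\<in>B. braket e x *s e))"
proof (induction "vec.dim S" arbitrary: S rule: less_induct)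
  case less
  note S = less.prems(1) and inv = less.prems(2)
  show ?case
  proof (cases "S \<subseteq> {0}")
    case True
    then show ?thesis
      by (intro exI[of _ "{}"]) (auto simp: orthonormal_def)
  next
    case False
    then obtain e z where e: "e \<in> S" "norm e = 1" "M *v e = z *s e"
      using invariant_subspace_unit_eigenvector[OF S inv] by blast
    have ee: "braket e e = 1"
      using e(2) norm_eq_1_iff_braket by blast
    define S' where "S' = {x \<in> S. braket e x = 0}"
    have S': "vec.subspace S'"
      using S unfolding S'_def vec.subspace_def by (auto simp: braket_add_right braket_scale_right)
    have inv': "\<forall>x\<in>S'. M *v x \<in> S'"
      using inv unitary_eigenvector_orthogonal_invariant[OF M e(3)] by (simp add: S'_def)
    have "e \<notin> S'"
      by (simp add: S'_def ee)
    then have "S' \<subset> S"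
      using e(1) unfolding S'_def by blast
    then have "vec.dim S' < vec.dim S"
      using vec.dim_psubset vec.span_eq_iff S S' by metis
    then obtain B lam where B: "finite B" "B \<subseteq> S'" "orthonormal B" "\<forall>e\<in>B. M *v e = lam e *s e"
      "\<forall>x\<in>S'. x = (\<Sum>e\<in>B. braket e x *s e)"
      using less.hyps[OF _ S' inv'] by blast
    have "e \<notin> B"
      using B(2) \<open>e \<notin> S'\<close> by blast
    show ?thesis
    proof (intro exI[of _ "insert e B"] exI[of _ "lam(e := z)"] conjI)
      show "\<forall>e'\<in>insert e B. M *v e' = (lam(e := z)) e' *s e'"
        using B(4) e(3) \<open>e \<notin> B\<close> by auto
    qed (use B e(1) orthonormal_insert_expansion[OF S e(1) ee B(1) _ B(3)] in \<open>auto simp: S'_def\<close>)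
  qed
qed

lemma unitary_eigenbasis:
  fixes M :: "complex^'n^'n"
  assumes M: "unitary_mat M"
  obtains B lam where "finite B" "orthonormal B" "\<forall>e\<in>B. M *v e = lam e *s e"
    "\<forall>e\<in>B. cmod (lam e) = 1" "\<forall>x. x = (\<Sum>e\<in>B. braket e x *s e)"
proof -
  obtain B lam where B: "finite B" "orthonormal B" "\<forall>e\<in>B. M *v e = lam e *s e"
    "\<forall>x. x = (\<Sum>e\<in>B. braket e x *s e)"
    using unitary_invariant_subspace_eigenbasis[OF M vec.subspace_UNIV] by auto
  moreover have "\<forall>e\<in>B. cmod (lam e) = 1"
  proof
    fix e assume "e \<in> B"
    then have "e \<noteq> 0"
      using B(2) orthonormalD[of B e e] by auto
    with \<open>e \<in> B\<close> show "cmod (lam e) = 1"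
      using B(3) unitary_eigenvalue_norm[OF M] by blast
  qed
  ultimately show ?thesis using that by blast
qed

section \<open>Simultaneous returns of a unitary matrix\<close>

lemma funpow_mat_linear:
  fixes M :: "'a::field^'n^'n"
  shows "Vector_Spaces.linear (*s) (*s) (((*v) M) ^^ k)"
proof (induction k)
  case 0
  show ?case unfolding funpow.simps(1) by (rule vec.linear_id)
next
  case (Suc k)
  then show ?case
    unfolding funpow.simps(2) by (rule Vector_Spaces.linear_compose[OF _ matrix_vector_mul_linear_gen])
qed

lemma funpow_mat_eigenvector:
  fixes M :: "'a::field^'n^'n"
  shows "M *v e = z *s e \<Longrightarrow> ((*v) M ^^ k) e = z ^ k *s e"
  by (induction k) (simp_all add: vector_scalar_commute mult.commute)

lemma funpow_mat_dist_orthonormal_eigenbasis: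
  assumes B: "finite B" "orthonormal B" and eig: "\<forall>e\<in>B. M *v e = lam e *s e"
    and close: "\<forall>e\<in>B. cmod (lam e ^ k - 1) \<le> \<delta>" and "0 \<le> \<delta>"
  shows "norm (((*v) M ^^ k) (\<Sum>e\<in>B. c e *s e) - (\<Sum>e\<in>B. c e *s e)) \<le> \<delta> * norm (\<Sum>e\<in>B. c e *s e)"
proof -
  have "((*v) M ^^ k) (\<Sum>e\<in>B. c e *s e) = (\<Sum>e\<in>B. c e *s ((*v) M ^^ k) e)"
    by (simp add: vec.linear_sum[OF funpow_mat_linear] vec.linear_scale[OF funpow_mat_linear])
  also have "\<dots> = (\<Sum>e\<in>B. (c e * lam e ^ k) *s e)"
  proof (rule sum.cong)
    fix e assume "e \<in> B"
    then have "((*v) M ^^ k) e = lam e ^ k *s e"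
      using eig funpow_mat_eigenvector by blast
    then show "c e *s ((*v) M ^^ k) e = (c e * lam e ^ k) *s e" by simp
  qed simp
  finally have "((*v) M ^^ k) (\<Sum>e\<in>B. c e *s e) - (\<Sum>e\<in>B. c e *s e) = (\<Sum>e\<in>B. (c e * (lam e ^ k - 1)) *s e)"
    by (simp add: sum_subtractf[symmetric] algebra_simps)
  then have "(norm (((*v) M ^^ k) (\<Sum>e\<in>B. c e *s e) - (\<Sum>e\<in>B. c e *s e)))\<^sup>2
      = (\<Sum>e\<in>B. (cmod (c e))\<^sup>2 * (cmod (lam e ^ k - 1))\<^sup>2)"
    by (simp add: norm_sum_orthonormal[OF B] norm_mult power_mult_distrib)
  also have "\<dots> \<le> (\<Sum>e\<in>B. (cmod (c e))\<^sup>2 * \<delta>\<^sup>2)"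
  proof (rule sum_mono)
    fix e assume "e \<in> B"
    with close \<open>0 \<le> \<delta>\<close> have "(cmod (lam e ^ k - 1))\<^sup>2 \<le> \<delta>\<^sup>2"
      by (simp add: power_mono)
    then show "(cmod (c e))\<^sup>2 * (cmod (lam e ^ k - 1))\<^sup>2 \<le> (cmod (c e))\<^sup>2 * \<delta>\<^sup>2"
      by (simp add: mult_left_mono)
  qed
  also have "\<dots> = (\<delta> * norm (\<Sum>e\<in>B. c e *s e))\<^sup>2"
    by (simp add: norm_sum_orthonormal[OF B] power_mult_distrib sum_distrib_left mult.commute)
  finally show ?thesis
    using \<open>0 \<le> \<delta>\<close> by (rule power2_le_imp_le[OF _ mult_nonneg_nonneg]) simp
qed

lemma norm_cis_minus_one_le: "cmod (cis t - 1) \<le> \<bar>t\<bar>"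
proof -
  have "(cmod (cis t - 1))\<^sup>2 = (cos t - 1)\<^sup>2 + (sin t)\<^sup>2"
    by (simp add: cmod_power2)
  also have "\<dots> = 2 - 2 * cos t"
    using sin_cos_squared_add[of t] by (simp add: power2_eq_square algebra_simps)
  also have "\<dots> = 4 * (sin (t/2))\<^sup>2"
    using cos_double_sin[of "t/2"] by simp
  also have "\<dots> \<le> 4 * (t/2)\<^sup>2"
    using abs_le_square_iff[THEN iffD1, OF abs_sin_x_le_abs_x[of "t/2"]] by simp
  also have "\<dots> = \<bar>t\<bar>\<^sup>2"
    by (simp add: power2_eq_square)
  finally show ?thesis
    by (rule power2_le_imp_le) simp
qed

lemma norm_unit_power_minus_one_le:
  fixes z :: complex and q p :: int
  assumes "cmod z = 1" "0 < q"
  shows "cmod (z ^ nat q - 1) \<le> 2 * pi * \<bar>of_int q * (Arg2pi z / (2 * pi)) - of_int p\<bar>"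
proof -
  define t where "t = 2 * pi * (of_int q * (Arg2pi z / (2 * pi)) - of_int p)"
  have z: "z = cis (Arg2pi z)"
    using assms(1) complex_norm_eq_1_exp[of z] by (simp add: cis_conv_exp)
  have "z ^ nat q = cis (real (nat q) * Arg2pi z)"
    by (subst (1) z) (rule Complex.DeMoivre)
  also have "real (nat q) * Arg2pi z = t + 2 * pi * of_int p"
    using assms(2) by (simp add: t_def field_simps)
  also have "cis (t + 2 * pi * of_int p) = cis t"
    by (simp add: cis_mult[symmetric] complex_eq_iff)
  finally have "cmod (z ^ nat q - 1) \<le> \<bar>t\<bar>"
    using norm_cis_minus_one_le by simp
  then show ?thesis
    by (simp add: t_def abs_mult)
qed

lemma ex_nat_2pi_div_le:
  assumes "0 < \<delta>" "\<delta> \<le> 1"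
  shows "\<exists>N>0. 2 * pi / real N \<le> \<delta> \<and> real N \<le> 10 / \<delta>"
proof (intro exI conjI)
  define N where "N = nat \<lceil>2 * pi / \<delta>\<rceil>"
  have "0 < 2 * pi / \<delta>"
    using assms by simp
  then have N: "2 * pi / \<delta> \<le> N" "N \<le> 2 * pi / \<delta> + 1"
    unfolding N_def by linarith+
  then have "real N > 0"
    using \<open>0 < 2 * pi / \<delta>\<close> by linarith
  then show "N > 0"
    by simp
  show "2 * pi / N \<le> \<delta>"
    using N(1) assms(1) \<open>real N > 0\<close> by (simp add: pos_divide_le_eq mult.commute)
  have "2 * pi / \<delta> + 1 \<le> (2 * pi + 1) / \<delta>"
    using assms by (simp add: field_simps)
  also have "\<dots> \<le> 10 / \<delta>"
    using assms pi_less_4 by (intro divide_right_mono) auto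
  finally show "real N \<le> 10 / \<delta>"
    using N(2) by linarith
qed

lemma Dirichlet_unit_circle:
  fixes lam :: "'b \<Rightarrow> complex"
  assumes B: "finite B" and unit: "\<forall>e\<in>B. cmod (lam e) = 1" and \<delta>: "0 < \<delta>" "\<delta> \<le> 1"
  shows "\<exists>k>0. real k \<le> (10 / \<delta>) ^ card B \<and> (\<forall>e\<in>B. cmod (lam e ^ k - 1) \<le> \<delta>)"
proof -
  obtain N where N: "N > 0" "2 * pi / real N \<le> \<delta>" "real N \<le> 10 / \<delta>"
    using ex_nat_2pi_div_le[OF \<delta>] by blast
  obtain f where f: "bij_betw f {0..<card B} B"
    using ex_bij_betw_nat_finite[OF B] by blast
  obtain q p where q: "0 < q" "q \<le> int (N ^ card B)" and qp: "\<And>i. i < card B \<Longrightarrow>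
      \<bar>of_int q * (Arg2pi (lam (f i)) / (2 * pi)) - of_int (p i)\<bar> < 1 / N"
    using Dirichlet_approx_simult[OF \<open>N > 0\<close>,
        where \<theta> = "\<lambda>i. Arg2pi (lam (f i)) / (2 * pi)" and n = "card B"]
    by blast
  have "cmod (lam e ^ nat q - 1) \<le> \<delta>" if "e \<in> B" for e
  proof -
    have "e \<in> f ` {0..<card B}"
      using f that by (simp add: bij_betw_def)
    then obtain i where i: "i < card B" "e = f i"
      by auto
    have "cmod (lam e ^ nat q - 1) \<le> 2 * pi * \<bar>of_int q * (Arg2pi (lam e) / (2 * pi)) - of_int (p i)\<bar>"
      using unit that q(1) by (blast intro: norm_unit_power_minus_one_le)
    also have "\<dots> \<le> 2 * pi * (1 / N)"
      using qp[OF i(1)] i(2) by (intro mult_left_mono) auto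
    finally show ?thesis
      using N(2) by simp
  qed
  moreover have "real (nat q) \<le> (10 / \<delta>) ^ card B"
  proof -
    have "nat q \<le> N ^ card B"
      using q(2) by linarith
    then have "real (nat q) \<le> real N ^ card B"
      by (metis of_nat_le_iff of_nat_power)
    also have "\<dots> \<le> (10 / \<delta>) ^ card B"
      using N(3) by (intro power_mono) auto
    finally show ?thesis .
  qed
  ultimately show ?thesis
    using q(1) by (intro exI[of _ "nat q"]) auto
qed

lemma unitary_power_near_identity:
  fixes M :: "complex^'n^'n"
  assumes M: "unitary_mat M" and \<delta>: "0 < \<delta>" "\<delta> \<le> 1"
  shows "\<exists>k>0. real k \<le> (10 / \<delta>) ^ CARD('n) \<and> (\<forall>x. norm (((*v) M ^^ k) x - x) \<le> \<delta> * norm x)"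
proof -
  obtain B lam where B: "finite B" "orthonormal B" and eig: "\<forall>e\<in>B. M *v e = lam e *s e"
    and unit: "\<forall>e\<in>B. cmod (lam e) = 1" and expand: "\<forall>x. x = (\<Sum>e\<in>B. braket e x *s e)"
    using unitary_eigenbasis[OF M] by blast
  obtain k where k: "k > 0" "real k \<le> (10 / \<delta>) ^ card B"
    and close: "\<forall>e\<in>B. cmod (lam e ^ k - 1) \<le> \<delta>"
    using Dirichlet_unit_circle[OF B(1) unit \<delta>] by blast
  have "1 \<le> 10 / \<delta>"
    using \<delta> by simp
  then have "real k \<le> (10 / \<delta>) ^ CARD('n)"
    using k(2) power_increasing[OF card_orthonormal_le[OF B]] by (meson order_trans)
  moreover have "norm (((*v) M ^^ k) x - x) \<le> \<delta> * norm x" for x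
  proof -
    have "norm (((*v) M ^^ k) (\<Sum>e\<in>B. braket e x *s e) - (\<Sum>e\<in>B. braket e x *s e))
        \<le> \<delta> * norm (\<Sum>e\<in>B. braket e x *s e)"
      using close \<delta>(1) by (intro funpow_mat_dist_orthonormal_eigenbasis[OF B eig]) auto
    then show ?thesis
      by (simp only: expand[rule_format, symmetric])
  qed
  ultimately show ?thesis
    using k(1) by blast
qed

section \<open>Runs over concatenated words\<close>

lemma qrun_Suc_shift: "qrun U s w (Suc n) = qrun U (U (w 0) *v s) (\<lambda>i. w (Suc i)) n"
  by (induction n) simp_all

text \<open>\<open>word_mat U x\<close> is the matrix \<open>U\<^sub>x\<close> of the paper.\<close>

fun word_mat :: "('a \<Rightarrow> complex^'n^'n) \<Rightarrow> 'a list \<Rightarrow> complex^'n^'n" where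
  "word_mat U [] = mat 1"
| "word_mat U (a # x) = word_mat U x ** U a"

lemma word_mat_append: "word_mat U (x @ y) = word_mat U y ** word_mat U x"
  by (induction x) (simp_all add: matrix_mul_assoc)

lemma unitary_word_mat: "\<forall>a. unitary_mat (U a) \<Longrightarrow> unitary_mat (word_mat U x)"
  by (induction x) (simp_all add: unitary_mat_one unitary_mat_mult)

lemma word_mat_word_pow: "word_mat U (word_pow w k) *v x = ((*v) (word_mat U w) ^^ k) x"
proof (induction k arbitrary: x)
  case (Suc k)
  have "word_pow w (Suc k) = w @ word_pow w k"
    by (simp add: word_pow_def)
  with Suc show ?case
    by (simp add: word_mat_append funpow_Suc_right matrix_vector_mul_assoc[symmetric] del: funpow.simps)
qed (simp add: word_pow_def)

lemma qrun_conc_word: "qrun U s (conc_word u v) (length u + m) = qrun U (word_mat U u *v s) v m"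
proof (induction u arbitrary: s)
  case Nil
  then show ?case by (simp add: conc_word_def)
next
  case (Cons a u)
  have shift: "(\<lambda>i. conc_word (a # u) v (Suc i)) = conc_word u v"
    unfolding conc_word_def by auto
  have head: "conc_word (a # u) v 0 = a"
    by (simp add: conc_word_def)
  have "qrun U s (conc_word (a # u) v) (length (a # u) + m)
      = qrun U (U a *v s) (conc_word u v) (length u + m)"
    using qrun_Suc_shift[of U s "conc_word (a # u) v" "length u + m"]
    by (simp only: shift head length_Cons add_Suc)
  also have "\<dots> = qrun U (word_mat U (a # u) *v s) v m"
    by (simp add: Cons.IH matrix_vector_mul_assoc)
  finally show ?case .
qed

lemma norm_qrun: "\<forall>a. unitary_mat (U a) \<Longrightarrow> norm (qrun U s w n) = norm s"
  by (induction n) (simp_all add: unitary_mat_norm)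

lemma dist_qrun: "\<forall>a. unitary_mat (U a) \<Longrightarrow> norm (qrun U x w n - qrun U y w n) = norm (x - y)"
  by (induction n) (simp_all add: unitary_mat_norm flip: matrix_vector_mult_diff_distrib)

section \<open>Stability of the acceptance value\<close>

definition buchi_value :: "(complex^'n) set \<Rightarrow> (nat \<Rightarrow> complex^'n) \<Rightarrow> real" where
  "buchi_value F s = Sup (insert 0
     {Inf (range (\<lambda>i::nat. (cmod (braket psi (s (r i))))\<^sup>2)) | psi r. psi \<in> F \<and> norm psi = 1 \<and> strict_mono r})"

lemma fND_eq_buchi_value: "fND U s0 F w = buchi_value F (qrun U s0 w)"
  unfolding fND_def buchi_value_def ..

lemma norm_braket_le_1:
  assumes "norm psi \<le> 1" "norm x \<le> 1"
  shows "cmod (braket psi x) \<le> 1"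
  using norm_braket_le[of psi x] mult_le_one[OF assms(1) norm_ge_zero assms(2)] by linarith

lemma overlap_le_dist:
  assumes "norm psi \<le> 1" "norm x \<le> 1" "norm y \<le> 1"
  shows "(cmod (braket psi x))\<^sup>2 \<le> (cmod (braket psi y))\<^sup>2 + 2 * norm (x - y)"
proof -
  define A B where "A = cmod (braket psi x)" and "B = cmod (braket psi y)"
  have "braket psi x = braket psi y + braket psi (x - y)"
    by (simp add: braket_diff_right)
  then have "A \<le> B + cmod (braket psi (x - y))"
    unfolding A_def B_def by (metis norm_triangle_ineq)
  also have "cmod (braket psi (x - y)) \<le> norm (x - y)"
    using norm_braket_le[of psi "x - y"] assms(1) mult_left_le_one_le[of "norm (x - y)" "norm psi"] by simp
  finally have "A - B \<le> norm (x - y)" by simp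
  moreover have "A + B \<le> 2" "0 \<le> A" "0 \<le> B"
    using norm_braket_le_1[of psi x] norm_braket_le_1[of psi y] assms by (auto simp: A_def B_def)
  ultimately have "(A - B) * (A + B) \<le> norm (x - y) * 2"
    by (cases "B \<le> A") (auto intro: mult_mono order_trans[OF mult_nonpos_nonneg])
  then have "A\<^sup>2 - B\<^sup>2 \<le> norm (x - y) * 2"
    by (simp add: power2_eq_square algebra_simps)
  then show ?thesis
    unfolding A_def B_def by simp
qed

text \<open>Each subsequence of \<open>s\<close> is shadowed by the correspondingly shifted subsequence of \<open>t\<close>.\<close>

lemma buchi_value_le_shifted:
  assumes s: "\<forall>n. norm (s n) \<le> 1" and t: "\<forall>n. norm (t n) \<le> 1"
    and close: "\<forall>m. norm (s (a + m) - t (b + m)) \<le> \<delta>"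
  shows "buchi_value F s \<le> buchi_value F t + 2 * \<delta>"
proof -
  define V where "V s = {Inf (range (\<lambda>i::nat. (cmod (braket psi (s (r i))))\<^sup>2)) | psi r.
    psi \<in> F \<and> norm psi = 1 \<and> strict_mono r}" for s :: "nat \<Rightarrow> _"
  have "v \<le> 1" if "v \<in> V t" for v
  proof -
    obtain psi r where v: "v = Inf (range (\<lambda>i::nat. (cmod (braket psi (t (r i))))\<^sup>2))" "norm psi = 1"
      using \<open>v \<in> V t\<close> unfolding V_def by blast
    have "v \<le> (cmod (braket psi (t (r 0))))\<^sup>2"
      unfolding v(1) by (rule cINF_lower[OF bdd_belowI[of _ 0]]) auto
    also have "\<dots> \<le> 1"
      using t v(2) norm_braket_le_1[of psi "t (r 0)"] by (intro power_le_one) auto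
    finally show ?thesis .
  qed
  then have bdd: "bdd_above (insert 0 (V t))"
    by (intro bdd_aboveI[of _ 1]) auto
  have "0 \<le> \<delta>"
    using close order_trans[OF norm_ge_zero] by blast
  have "Sup (insert 0 (V s)) \<le> Sup (insert 0 (V t)) + 2 * \<delta>"
  proof (rule cSup_least)
    fix v assume "v \<in> insert 0 (V s)"
    then consider "v = 0" | psi r where "v = Inf (range (\<lambda>i::nat. (cmod (braket psi (s (r i))))\<^sup>2))"
      "psi \<in> F" "norm psi = 1" "strict_mono r"
      unfolding V_def by blast
    then show "v \<le> Sup (insert 0 (V t)) + 2 * \<delta>"
    proof cases
      case 1
      then show ?thesis
        using cSup_upper[OF insertI1 bdd] \<open>0 \<le> \<delta>\<close> by simp
    next
      case 2
      define r' where "r' i = r (i + a) - a + b" for i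
      have ra: "a \<le> r (i + a)" for i
        using seq_suble[OF 2(4), of "i + a"] by simp
      have "strict_mono r'"
        unfolding strict_mono_Suc_iff
      proof
        fix i
        have "r (i + a) < r (Suc i + a)"
          using 2(4) by (simp add: strict_mono_def)
        then show "r' i < r' (Suc i)"
          using ra[of i] by (simp add: r'_def)
      qed
      have "v - 2 * \<delta> \<le> (cmod (braket psi (t (r' i))))\<^sup>2" for i
      proof -
        define m where "m = r (i + a) - a"
        have shifted: "r (i + a) = a + m" "r' i = b + m"
          using ra[of i] by (simp_all add: m_def r'_def)
        have "v \<le> (cmod (braket psi (s (r (i + a)))))\<^sup>2"
          unfolding 2(1) by (rule cINF_lower[OF bdd_belowI[of _ 0]]) auto
        also have "\<dots> \<le> (cmod (braket psi (t (r' i))))\<^sup>2 + 2 * norm (s (r (i + a)) - t (r' i))"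
          using s t 2(3) by (simp add: overlap_le_dist)
        also have "norm (s (r (i + a)) - t (r' i)) \<le> \<delta>"
          using close unfolding shifted by blast
        finally show ?thesis by simp
      qed
      then have "v - 2 * \<delta> \<le> Inf (range (\<lambda>i::nat. (cmod (braket psi (t (r' i))))\<^sup>2))"
        by (intro cINF_greatest) auto
      also have "\<dots> \<le> Sup (insert 0 (V t))"
        using 2 \<open>strict_mono r'\<close> by (intro cSup_upper[OF _ bdd]) (auto simp: V_def)
      finally show ?thesis by simp
    qed
  qed simp
  then show ?thesis
    unfolding buchi_value_def V_def .
qed

section \<open>Pumping\<close>

lemma fND_insert_near_identity:
  fixes U :: "'a \<Rightarrow> complex^'n^'n"
  assumes U: "\<forall>a. unitary_mat (U a)" and "norm s0 = 1"
    and near: "\<forall>x. norm (word_mat U y *v x - x) \<le> \<delta> * norm x"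
  shows "\<bar>fND U s0 F (conc_word u v) - fND U s0 F (conc_word (u @ y) v)\<bar> \<le> 2 * \<delta>"
proof -
  define x where "x = word_mat U u *v s0"
  define s where "s = qrun U s0 (conc_word u v)"
  define t where "t = qrun U s0 (conc_word (u @ y) v)"
  have "s (length u + m) = qrun U x v m" for m
    by (simp add: s_def x_def qrun_conc_word)
  moreover have "t (length (u @ y) + m) = qrun U (word_mat U y *v x) v m" for m
    unfolding t_def qrun_conc_word by (simp add: x_def word_mat_append flip: matrix_vector_mul_assoc)
  moreover have "norm x = 1"
    using \<open>norm s0 = 1\<close> by (simp add: x_def unitary_mat_norm[OF unitary_word_mat[OF U]])
  then have "norm (x - word_mat U y *v x) \<le> \<delta>"
    using near[rule_format, of x] by (simp add: norm_minus_commute)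
  ultimately have st: "\<forall>m. norm (s (length u + m) - t (length (u @ y) + m)) \<le> \<delta>"
    and ts: "\<forall>m. norm (t (length (u @ y) + m) - s (length u + m)) \<le> \<delta>"
    by (simp_all add: dist_qrun[OF U] norm_minus_commute)
  have s: "\<forall>n. norm (s n) \<le> 1" and t: "\<forall>n. norm (t n) \<le> 1"
    using \<open>norm s0 = 1\<close> by (simp_all add: s_def t_def norm_qrun[OF U])
  have "buchi_value F s \<le> buchi_value F t + 2 * \<delta>" "buchi_value F t \<le> buchi_value F s + 2 * \<delta>"
    by (rule buchi_value_le_shifted[OF s t st], rule buchi_value_le_shifted[OF t s ts])
  then show ?thesis
    unfolding fND_eq_buchi_value s_def[symmetric] t_def[symmetric] by linarith
qed

lemma fND_pumping:
  fixes s0 :: "complex^'n" and U :: "'a::finite \<Rightarrow> complex^'n^'n"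
  assumes QA: "is_QA s0 U F" and \<epsilon>: "0 < \<epsilon>" "\<epsilon> \<le> 1"
  shows "\<exists>k>0. real k \<le> (\<epsilon> / 20) powr (- real CARD('n)) \<and> (\<forall>u v.
    \<bar>fND U s0 F (conc_word u v) - fND U s0 F (conc_word (u @ word_pow w k) v)\<bar> \<le> \<epsilon>)"
proof -
  have U: "\<forall>a. unitary_mat (U a)" and "norm s0 = 1"
    using QA by (auto simp: is_QA_def)
  have "0 < \<epsilon> / 2" "\<epsilon> / 2 \<le> 1"
    using \<epsilon> by auto
  then obtain k where k: "k > 0" "real k \<le> (10 / (\<epsilon> / 2)) ^ CARD('n)"
    and near: "\<forall>x. norm (((*v) (word_mat U w) ^^ k) x - x) \<le> \<epsilon> / 2 * norm x"
    using unitary_power_near_identity[OF unitary_word_mat[OF U, of w]] by blast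
  have "(10 / (\<epsilon> / 2)) ^ CARD('n) = (\<epsilon> / 20) powr (- real CARD('n))"
    using \<epsilon> by (simp add: powr_minus_divide powr_realpow power_divide)
  moreover have "\<bar>fND U s0 F (conc_word u v) - fND U s0 F (conc_word (u @ word_pow w k) v)\<bar> \<le> \<epsilon>" for u v
    using fND_insert_near_identity[OF U \<open>norm s0 = 1\<close>, of "word_pow w k" "\<epsilon> / 2"] near
    by (simp add: word_mat_word_pow)
  ultimately show ?thesis
    using k by auto
qed

theorem theorem1:
  fixes s0 :: "complex^'n" and U :: "'a::finite \<Rightarrow> complex^'n^'n" and F :: "(complex^'n) set"
  assumes "is_QA s0 U F"
  shows "(\<forall>(w::'a list) (\<epsilon>::real). w \<noteq> [] \<longrightarrow> \<epsilon> > 0 \<longrightarrow>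
            (\<exists>k::nat. k > 0 \<and> (\<forall>u (v::nat \<Rightarrow> 'a).
               \<bar>fND U s0 F (conc_word u v) - fND U s0 F (conc_word (u @ word_pow w k) v)\<bar> \<le> \<epsilon>)))
       \<and> (\<exists>c::real. c > 0 \<and>
            (\<forall>(s0'::complex^'n) (U'::'a \<Rightarrow> complex^'n^'n) F'. is_QA s0' U' F' \<longrightarrow>
              (\<forall>(w::'a list) (\<epsilon>::real). w \<noteq> [] \<longrightarrow> 0 < \<epsilon> \<longrightarrow> \<epsilon> \<le> 1 \<longrightarrow>
                (\<exists>k::nat. k > 0 \<and> real k \<le> (c * \<epsilon>) powr (- real CARD('n)) \<and>
                  (\<forall>u (v::nat \<Rightarrow> 'a).
                    \<bar>fND U' s0' F' (conc_word u v) - fND U' s0' F' (conc_word (u @ word_pow w k) v)\<bar> \<le> \<epsilon>)))))"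
proof (intro conjI allI impI exI[of _ "1/20"])
  fix w :: "'a list" and \<epsilon> :: real
  assume "w \<noteq> []" "0 < \<epsilon>"
  then obtain k where "k > 0" and "\<forall>u v.
      \<bar>fND U s0 F (conc_word u v) - fND U s0 F (conc_word (u @ word_pow w k) v)\<bar> \<le> min \<epsilon> 1"
    using fND_pumping[OF assms, of "min \<epsilon> 1" w] by auto
  then show "\<exists>k>0. \<forall>u v. \<bar>fND U s0 F (conc_word u v) - fND U s0 F (conc_word (u @ word_pow w k) v)\<bar> \<le> \<epsilon>"
    by (meson min.boundedE)
qed (simp_all add: fND_pumping)

end
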